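(* For every integer $d\ge0$, every graph of tree-length $d$ is $\lfloor\frac32 d\rfloor$-hyperbolic. This value is sharp for every integer $d\ge 0$: there exists a graph of tree-length $d$ that is not $c$-hyperbolic for any real $c$ with $0\le c<\lfloor\frac32 d\rfloor$.
   Context: Graphs are simple and undirected. A tree-decomposition of a graph $G=(V,E)$ is a pair $(T,(V_t)_{t\in T})$ of a tree $T$ and a family of vertex sets $V_t\subseteq V$ (its parts), indexed by the nodes of $T$, such that (T1) $V=\bigcup_t V_t$; (T2) for every edge of $G$ some $V_t$ contains both its ends; (T3) $V_{t_1}\cap V_{t_3}\subseteq V_{t_2}$ whenever $t_2$ lies on the path between $t_1$ and $t_3$ in $T$. The tree-length of $G$ is the smallest value, minimized over all tree-decompositions of $G$, of the maximum distance $d_G(u,v)$ in $G$ (not in the subgraph induced by the part) between any two vertices $u,v$ lying in a common part of the decomposition. Given a real number $d\ge0$, a graph $G$ is $d$-hyperbolic if whenever vertices $x,y,z$ are linked by shortest paths $P_{xy}=x\dots y$, $P_{yz}=y\dots z$ and $P_{xz}=x\dots z$ in $G$, each of these paths lies within distance $d$ of the other two, i.e. every vertex of each of the three paths has distance (in $G$) at most $d$ from some vertex of the union of the other two paths. *)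

theory Defs
  imports Complex_Main "HOL-Library.Extended_Nat" "HOL-Library.Extended_Real"
begin

text \<open>Vertex sets may be infinite, and graphs may be disconnected or empty.\<close>

datatype 'a graph = Graph (verts: "'a set") (edges: "'a set set")

definition simple_graph :: "'a graph \<Rightarrow> bool" where
  "simple_graph G \<longleftrightarrow> (\<forall>e\<in>edges G. e \<subseteq> verts G \<and> card e = 2)"

definition is_path :: "'a graph \<Rightarrow> 'a list \<Rightarrow> bool" where
  "is_path G p \<longleftrightarrow>
     p \<noteq> [] \<and> distinct p \<and> set p \<subseteq> verts G \<and> successively (\<lambda>u v. {u, v} \<in> edges G) p"

definition path_between :: "'a graph \<Rightarrow> 'a \<Rightarrow> 'a \<Rightarrow> 'a list \<Rightarrow> bool" where
  "path_between G x y p \<longleftrightarrow> is_path G p \<and> hd p = x \<and> last p = y"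

text \<open>Paths are lists of vertices; the length of a path is its number of edges.\<close>

definition path_length :: "'a list \<Rightarrow> nat" where
  "path_length p = length p - 1"

text \<open>The distance is \<open>\<infinity>\<close> if no path exists.\<close>

definition graph_dist :: "'a graph \<Rightarrow> 'a \<Rightarrow> 'a \<Rightarrow> enat" where
  "graph_dist G u v = (INF p\<in>{p. path_between G u v p}. enat (path_length p))"

definition shortest_path :: "'a graph \<Rightarrow> 'a \<Rightarrow> 'a \<Rightarrow> 'a list \<Rightarrow> bool" where
  "shortest_path G x y p \<longleftrightarrow>
     path_between G x y p \<and> enat (path_length p) = graph_dist G x y"

definition connected_graph :: "'a graph \<Rightarrow> bool" where
  "connected_graph G \<longleftrightarrow>
     verts G \<noteq> {} \<and> (\<forall>x\<in>verts G. \<forall>y\<in>verts G. \<exists>p. path_between G x y p)"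

definition is_cycle :: "'a graph \<Rightarrow> 'a list \<Rightarrow> bool" where
  "is_cycle G c \<longleftrightarrow> is_path G c \<and> length c \<ge> 3 \<and> {last c, hd c} \<in> edges G"

definition is_tree :: "'a graph \<Rightarrow> bool" where
  "is_tree T \<longleftrightarrow> simple_graph T \<and> connected_graph T \<and> (\<nexists>c. is_cycle T c)"

definition tree_decomposition :: "'a graph \<Rightarrow> 't graph \<Rightarrow> ('t \<Rightarrow> 'a set) \<Rightarrow> bool" where
  "tree_decomposition G T part \<longleftrightarrow>
     is_tree T \<and>
     verts G = (\<Union>t\<in>verts T. part t) \<and>
     (\<forall>e\<in>edges G. \<exists>t\<in>verts T. e \<subseteq> part t) \<and>
     (\<forall>t1 t2 t3 p. path_between T t1 t3 p \<and> t2 \<in> set p \<longrightarrow> part t1 \<inter> part t3 \<subseteq> part t2)"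

definition decomposition_length :: "'a graph \<Rightarrow> 't graph \<Rightarrow> ('t \<Rightarrow> 'a set) \<Rightarrow> enat" where
  "decomposition_length G T part =
     (SUP t\<in>verts T. SUP u\<in>part t. SUP v\<in>part t. graph_dist G u v)"

text \<open>
  The infimum is a minimum, since \<^typ>\<open>enat\<close> is well-ordered. HOL cannot quantify over the type
  of tree nodes in a definition, so the nodes are taken from \<^typ>\<open>'a list\<close>. The lemma
  \<open>tree_length_le_decomposition_length\<close> below shows that decompositions
  over trees of any other node type do not give a smaller value.
\<close>

definition tree_length :: "'a graph \<Rightarrow> enat" where
  "tree_length G =
     Inf {decomposition_length G T part | (T :: 'a list graph) part. tree_decomposition G T part}"

definition within_dist :: "'a graph \<Rightarrow> real \<Rightarrow> 'a set \<Rightarrow> 'a set \<Rightarrow> bool" where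
  "within_dist G c A B \<longleftrightarrow> (\<forall>v\<in>A. \<exists>w\<in>B. ereal_of_enat (graph_dist G v w) \<le> ereal c)"

definition hyperbolic :: "real \<Rightarrow> 'a graph \<Rightarrow> bool" where
  "hyperbolic c G \<longleftrightarrow>
     (\<forall>x\<in>verts G. \<forall>y\<in>verts G. \<forall>z\<in>verts G. \<forall>Pxy Pyz Pxz.
        shortest_path G x y Pxy \<and> shortest_path G y z Pyz \<and> shortest_path G x z Pxz \<longrightarrow>
        within_dist G c (set Pxy) (set Pyz \<union> set Pxz) \<and>
        within_dist G c (set Pyz) (set Pxy \<union> set Pxz) \<and>
        within_dist G c (set Pxz) (set Pxy \<union> set Pyz))"


lemma path_between_rev:
  assumes "path_between G x y p"
  shows "path_between G y x (rev p)"
  using assms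
  by (auto simp: path_between_def is_path_def hd_rev last_rev successively_rev insert_commute)

lemma path_between_trans:
  assumes "path_between G x y p" "path_between G y z q"
  shows "\<exists>r. path_between G x z r"
  using assms(1)
proof (induction p arbitrary: x)
  case Nil
  then show ?case by (simp add: path_between_def is_path_def)
next
  case (Cons a p)
  show ?case
  proof (cases "p = []")
    case True
    with Cons.prems assms(2) show ?thesis by (auto simp: path_between_def)
  next
    case False
    with Cons.prems have "path_between G (hd p) y p" and ax: "a = x" "x \<in> verts G"
      and e: "{x, hd p} \<in> edges G"
      by (auto simp: path_between_def is_path_def successively_Cons)
    from Cons.IH[OF this(1)] obtain r where r: "path_between G (hd p) z r" by blast
    show ?thesis
    proof (cases "x \<in> set r")
      case True
      then obtain r1 r2 where "r = r1 @ x # r2" by (meson split_list)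
      with r have "path_between G x z (x # r2)"
        by (auto simp: path_between_def is_path_def successively_append_iff split: if_splits)
      then show ?thesis by blast
    next
      case False
      with r e ax have "path_between G x z (x # r)"
        by (auto simp: path_between_def is_path_def successively_Cons)
      then show ?thesis by blast
    qed
  qed
qed

lemma tree_length_le_decomposition_length:
  fixes G :: "'a graph" and T :: "'t graph"
  assumes G: "simple_graph G" and td: "tree_decomposition G T part"
  shows "tree_length G \<le> decomposition_length G T part"
proof -
  have tree: "simple_graph T" "connected_graph T" "\<nexists>c. is_cycle T c"
    and T1: "verts G = (\<Union>t\<in>verts T. part t)"
    and T2: "\<And>e. e \<in> edges G \<Longrightarrow> \<exists>t\<in>verts T. e \<subseteq> part t"
    and T3: "\<And>t1 t2 t3 p. path_between T t1 t3 p \<Longrightarrow> t2 \<in> set p \<Longrightarrow> part t1 \<inter> part t3 \<subseteq> part t2"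
    using td unfolding tree_decomposition_def is_tree_def by (simp_all, blast+)
  obtain r where r: "r \<in> verts T"
    using tree(2) by (auto simp: connected_graph_def)
  obtain P where P: "\<And>t. t \<in> verts T \<Longrightarrow> path_between T r t (P t)"
    using tree(2) r unfolding connected_graph_def by metis
  define D where "D = {(u, v). {u, v} \<subseteq> verts G \<and> (u = v \<or> {u, v} \<in> edges G)}"
  have "\<exists>t\<in>verts T. {fst x, snd x} \<subseteq> part t" if "x \<in> D" for x
  proof (cases "fst x = snd x")
    case True
    have "fst x \<in> verts G" using that by (auto simp: D_def)
    with T1 True show ?thesis by auto
  next
    case False
    then have "{fst x, snd x} \<in> edges G" using that by (auto simp: D_def)
    then show ?thesis by (rule T2)
  qed
  then obtain g where g: "\<And>x. x \<in> D \<Longrightarrow> g x \<in> verts T \<and> {fst x, snd x} \<subseteq> part (g x)"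
    by metis
  define S where "S = insert r (\<Union>x\<in>D. set (P (g x)))"
  define h where "h = (\<lambda>xs. if xs = [] then r else P (g (xs ! 0, xs ! 1)) ! (length xs - 2))"
  have "S \<subseteq> range h"
  proof
    fix s assume "s \<in> S"
    then consider "s = r" | u v where "(u, v) \<in> D" "s \<in> set (P (g (u, v)))"
      by (auto simp: S_def)
    then show "s \<in> range h"
    proof cases
      case 1
      then have "s = h []" by (simp add: h_def)
      then show ?thesis by blast
    next
      case 2
      then obtain n where "s = P (g (u, v)) ! n" by (metis in_set_conv_nth)
      then have "s = h (u # v # replicate n u)" by (simp add: h_def)
      then show ?thesis by blast
    qed
  qed
  define k where "k = inv h"
  have hk: "h (k s) = s" if "s \<in> S" for s
    using that \<open>S \<subseteq> range h\<close> by (auto simp: k_def f_inv_into_f)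
  have ST: "S \<subseteq> verts T"
    using r P g by (fastforce simp: S_def path_between_def is_path_def)
  define T' where "T' = Graph (k ` S) ((`) k ` {e \<in> edges T. e \<subseteq> S})"
  have vT': "verts T' = k ` S" by (simp add: T'_def)
  have eT': "h ` e \<in> edges T" if e: "e \<in> edges T'" for e
  proof -
    obtain e' where e': "e = k ` e'" "e' \<in> edges T" "e' \<subseteq> S"
      using e unfolding T'_def graph.sel by blast
    have "h ` e = (\<lambda>s. s) ` e'" unfolding e' image_image
      by (rule image_cong) (use hk e' in auto)
    then have "h ` e = e'" by simp
    with e' show ?thesis by simp
  qed
  have injh: "inj_on h (k ` S)" using hk by (auto simp: inj_on_def)
  have injk: "inj_on k S" using hk by (metis inj_onI)
  have down: "path_between T (h a) (h b) (map h q)" if q: "path_between T' a b q" for a b q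
  proof -
    have e: "{h u, h v} \<in> edges T" if "{u, v} \<in> edges T'" for u v
      using eT'[OF that] by simp
    have "successively (\<lambda>u v. {u, v} \<in> edges T') q"
      using q by (simp add: path_between_def is_path_def)
    then have "successively (\<lambda>u v. {h u, h v} \<in> edges T) q"
      by (rule successively_mono) (use e in blast)
    moreover have "set (map h q) \<subseteq> verts T"
      using q ST hk by (force simp: path_between_def is_path_def vT')
    ultimately show ?thesis
      using q injh
      by (auto simp: path_between_def is_path_def vT' hd_map last_map distinct_map successively_map
          intro: inj_on_subset)
  qed
  have up: "path_between T' (k a) (k b) (map k p)"
    if p: "path_between T a b p" "set p \<subseteq> S" for a b p
  proof -
    have e: "{k u, k v} \<in> edges T'" if "{u, v} \<in> edges T" "u \<in> S" "v \<in> S" for u v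
      using that by (auto simp: T'_def intro!: image_eqI[of _ _ "{u, v}"])
    have "successively (\<lambda>u v. {u, v} \<in> edges T) p"
      using p by (simp add: path_between_def is_path_def)
    then have "successively (\<lambda>u v. {k u, k v} \<in> edges T') p"
      by (rule successively_mono) (use e p(2) in blast)
    then show ?thesis
      using p injk
      by (auto simp: path_between_def is_path_def vT' hd_map last_map distinct_map successively_map
          intro: inj_on_subset)
  qed
  have reach: "\<exists>p. path_between T' (k r) (k s) p" if s: "s \<in> S" for s
  proof -
    have "\<exists>p. path_between T r s p \<and> set p \<subseteq> S"
    proof (cases "s = r")
      case True
      have "path_between T r s [r]" using True r by (simp add: path_between_def is_path_def)
      moreover have "set [r] \<subseteq> S" by (simp add: S_def)
      ultimately show ?thesis by blast
    next
      case False
      then obtain x where x: "x \<in> D" "s \<in> set (P (g x))" using s by (auto simp: S_def)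
      then obtain p1 p2 where p: "P (g x) = p1 @ s # p2" by (meson split_list)
      have "path_between T r (g x) (P (g x))" using P g x by blast
      then have "path_between T r s (p1 @ [s])"
        unfolding p
        by (cases "p1 = []") (auto simp: path_between_def is_path_def successively_append_iff)
      moreover have "set (p1 @ [s]) \<subseteq> S" using x p by (force simp: S_def)
      ultimately show ?thesis by blast
    qed
    then show ?thesis using up by blast
  qed
  have "is_tree T'"
    unfolding is_tree_def
  proof (intro conjI)
    show "simple_graph T'"
      using tree(1) injk
      by (auto simp: simple_graph_def T'_def intro!: card_image[THEN trans] intro: inj_on_subset)
    show "connected_graph T'"
      unfolding connected_graph_def vT'
    proof (intro conjI ballI)
      show "k ` S \<noteq> {}" by (simp add: S_def)
      fix x y assume "x \<in> k ` S" "y \<in> k ` S"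
      then obtain p q where "path_between T' (k r) x p" "path_between T' (k r) y q"
        using reach by blast
      then show "\<exists>p. path_between T' x y p"
        using path_between_rev path_between_trans by metis
    qed
    show "\<nexists>c. is_cycle T' c"
    proof
      assume "\<exists>c. is_cycle T' c"
      then obtain c where c: "is_cycle T' c" by blast
      then have "path_between T (h (hd c)) (h (last c)) (map h c)"
        by (intro down) (auto simp: is_cycle_def path_between_def)
      moreover have "{h (last c), h (hd c)} \<in> edges T"
        using c eT'[of "{last c, hd c}"] by (auto simp: is_cycle_def)
      ultimately have "is_cycle T (map h c)"
        using c by (auto simp: is_cycle_def path_between_def)
      with tree(3) show False by blast
    qed
  qed
  have gS: "g x \<in> S" if x: "x \<in> D" for x
  proof -
    have "path_between T r (g x) (P (g x))" using P g x by blast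
    then have "g x \<in> set (P (g x))"
      using last_in_set[of "P (g x)"] by (simp add: path_between_def is_path_def)
    with x show ?thesis by (auto simp: S_def)
  qed
  have "tree_decomposition G T' (part \<circ> h)"
    unfolding tree_decomposition_def
  proof (intro conjI ballI allI impI)
    show "is_tree T'" by fact
    show "verts G = (\<Union>t\<in>verts T'. (part \<circ> h) t)"
    proof
      show "verts G \<subseteq> (\<Union>t\<in>verts T'. (part \<circ> h) t)"
      proof
        fix v assume "v \<in> verts G"
        then have "(v, v) \<in> D" by (simp add: D_def)
        then show "v \<in> (\<Union>t\<in>verts T'. (part \<circ> h) t)"
          using g[of "(v, v)"] gS[of "(v, v)"] hk by (force simp: vT')
      qed
      show "(\<Union>t\<in>verts T'. (part \<circ> h) t) \<subseteq> verts G"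
        using T1 ST hk by (auto simp: vT')
    qed
    fix e assume e: "e \<in> edges G"
    then obtain u v where uv: "e = {u, v}" using G by (auto simp: simple_graph_def card_2_iff)
    with e G have "(u, v) \<in> D" by (auto simp: D_def simple_graph_def)
    then show "\<exists>t\<in>verts T'. e \<subseteq> (part \<circ> h) t"
      using g[of "(u, v)"] gS[of "(u, v)"] hk uv by (auto simp: vT')
  next
    fix t1 t2 t3 p
    assume "path_between T' t1 t3 p \<and> t2 \<in> set p"
    then show "(part \<circ> h) t1 \<inter> (part \<circ> h) t3 \<subseteq> (part \<circ> h) t2"
      using T3[OF down, of t1 t3 p "h t2"] by auto
  qed
  then have "tree_length G \<le> decomposition_length G T' (part \<circ> h)"
    unfolding tree_length_def by (intro Inf_lower) blast
  also have "\<dots> \<le> decomposition_length G T part"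
    unfolding decomposition_length_def
  proof (rule SUP_mono)
    fix t assume "t \<in> verts T'"
    then have "h t \<in> verts T" using ST hk by (auto simp: vT')
    then show "\<exists>t'\<in>verts T. (SUP u\<in>(part \<circ> h) t. SUP v\<in>(part \<circ> h) t. graph_dist G u v)
        \<le> (SUP u\<in>part t'. SUP v\<in>part t'. graph_dist G u v)"
      by (intro bexI[of _ "h t"]) simp_all
  qed
  finally show ?thesis .
qed

end

theory Submission
  imports Defs "HOL-Library.Nat_Bijection"
begin

text \<open>
  Upper bound: let \<open>v\<close> lie on the side \<open>P\<close> of a geodesic triangle and let \<open>Q\<close> be the walk formed by
  the other two sides. Follow the tree from a part containing \<open>v\<close> to the first part \<open>V\<^sub>s\<close> that meets
  \<open>Q\<close>, and let \<open>V\<^sub>r\<close> be the part just before it. The adhesion set \<open>V\<^sub>r \<inter> V\<^sub>s\<close> separates \<open>v\<close> from \<open>Q\<close>, so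
  it meets \<open>P\<close> on both sides of \<open>v\<close>; as these two vertices have distance at most \<open>d\<close> along the
  geodesic \<open>P\<close>, one of them has distance at most \<open>d/2\<close> from \<open>v\<close>, and it has distance at most \<open>d\<close> from a
  vertex of \<open>Q\<close> in \<open>V\<^sub>s\<close>.

  Sharpness: let \<open>m = \<lfloor>d/2\<rfloor>\<close> and consider the grid with king's moves on the union of the rectangles
  \<open>[0,d] \<times> [m,m+d]\<close>, \<open>[d,2d] \<times> [m,m+d]\<close>, \<open>[2d,3d] \<times> [m,m+d]\<close> and \<open>[d,2d] \<times> [0,m]\<close>, where every move
  stays inside one rectangle. The rectangles, arranged in a star around the second one, form
  a tree-decomposition of length at most \<open>d\<close>. The upper side of the grid and the V-shaped path with
  the same ends and its tip at \<open>(d+m, 0)\<close> are both geodesics, since the first coordinate is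
  1-Lipschitz; the second coordinate shows that the tip has distance \<open>d+m\<close> from the upper side.
  By the upper bound the tree-length cannot be smaller than \<open>d\<close>.
\<close>

section \<open>Distances in graphs\<close>

text \<open>Vertices may repeat, so walks can be joined without restoring distinctness; distance
  bounds survive because a walk can be shortened to a path with the same ends.\<close>

definition is_walk :: "'a graph \<Rightarrow> 'a list \<Rightarrow> bool" where
  "is_walk G p \<longleftrightarrow> p \<noteq> [] \<and> set p \<subseteq> verts G \<and> successively (\<lambda>u v. {u, v} \<in> edges G) p"

lemma path_between_imp_walk: "path_between G x y p \<Longrightarrow> is_walk G p \<and> hd p = x \<and> last p = y"
  by (simp add: path_between_def is_path_def is_walk_def)

lemma is_walk_rev: "is_walk G (rev p) \<longleftrightarrow> is_walk G p"
  by (simp add: is_walk_def successively_rev insert_commute)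

lemma is_walk_append_tl:
  assumes "is_walk G p" "is_walk G q" "last p = hd q"
  shows "is_walk G (p @ tl q)" "hd (p @ tl q) = hd p" "last (p @ tl q) = last q"
    "set (p @ tl q) = set p \<union> set q"
proof -
  obtain a q' where q: "q = a # q'" using assms(2) by (cases q) (auto simp: is_walk_def)
  have "a \<in> set p" using assms q last_in_set[of p] by (auto simp: is_walk_def)
  then show "set (p @ tl q) = set p \<union> set q" using q by auto
  show "is_walk G (p @ tl q)"
    using assms q by (cases q') (auto simp: is_walk_def successively_append_iff successively_Cons)
  show "hd (p @ tl q) = hd p" "last (p @ tl q) = last q"
    using assms q by (auto simp: is_walk_def)
qed

lemma is_walk_take: "is_walk G p \<Longrightarrow> 0 < n \<Longrightarrow> is_walk G (take n p)"
  using set_take_subset[of n p] successively_append_iff[of _ "take n p" "drop n p"]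
  by (auto simp: is_walk_def)

lemma is_walk_drop: "is_walk G p \<Longrightarrow> n < length p \<Longrightarrow> is_walk G (drop n p)"
  using set_drop_subset[of n p] successively_append_iff[of _ "take n p" "drop n p"]
  by (auto simp: is_walk_def)

lemma walk_imp_path:
  "is_walk G p \<Longrightarrow> \<exists>q. path_between G (hd p) (last p) q \<and> length q \<le> length p"
proof (induction p)
  case Nil
  then show ?case by (simp add: is_walk_def)
next
  case (Cons a p)
  show ?case
  proof (cases "p = []")
    case True
    with Cons.prems have "path_between G a a [a]"
      by (simp add: is_walk_def path_between_def is_path_def)
    with True show ?thesis by auto
  next
    case False
    with Cons.prems have w: "is_walk G p" "a \<in> verts G" "{a, hd p} \<in> edges G"
      by (auto simp: is_walk_def successively_Cons)
    from Cons.IH[OF w(1)] obtain q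
      where q: "path_between G (hd p) (last p) q" "length q \<le> length p" by blast
    show ?thesis
    proof (cases "a \<in> set q")
      case True
      \<comment> \<open>The loop from \<open>a\<close> back to \<open>a\<close> is cut out: the
        suffix of \<open>q\<close> starting at \<open>a\<close> is already a path.\<close>
      then obtain q1 q2 where "q = q1 @ a # q2" by (meson split_list)
      with q False have "path_between G a (last p) (a # q2)" "length (a # q2) \<le> length (a # p)"
        by (auto simp: path_between_def is_path_def successively_append_iff split: if_splits)
      with False show ?thesis by (auto intro!: exI[of _ "a # q2"])
    next
      case aq: False
      with q w have "path_between G a (last p) (a # q)"
        by (auto simp: path_between_def is_path_def successively_Cons)
      with q False show ?thesis by (auto intro!: exI[of _ "a # q"])
    qed
  qed
qed

section \<open>Upper and lower bounds for distances\<close>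

lemma graph_dist_le_walk:
  assumes "is_walk G p"
  shows "graph_dist G (hd p) (last p) \<le> enat (length p - 1)"
proof -
  obtain q where q: "path_between G (hd p) (last p) q" "length q \<le> length p"
    using walk_imp_path[OF assms] by blast
  have "graph_dist G (hd p) (last p) \<le> enat (path_length q)"
    unfolding graph_dist_def using q by (intro INF_lower) simp
  also have "\<dots> \<le> enat (length p - 1)" using q(2) by (simp add: path_length_def)
  finally show ?thesis .
qed

lemma graph_dist_leE:
  assumes "graph_dist G u v \<le> enat n"
  obtains p where "path_between G u v p" "path_length p \<le> n"
proof -
  \<comment> \<open>In strict form the bound on the infimum yields an actual path.\<close>
  have "graph_dist G u v < enat (Suc n)" using assms by (simp add: order_le_less_trans)
  then show ?thesis using that unfolding graph_dist_def INF_less_iff by (auto simp: less_Suc_eq_le)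
qed

lemma graph_dist_self: "x \<in> verts G \<Longrightarrow> graph_dist G x x = 0"
  using graph_dist_le_walk[of G "[x]"] by (simp add: is_walk_def zero_enat_def[symmetric])

lemma graph_dist_triangle:
  assumes "graph_dist G u v \<le> enat m" "graph_dist G v w \<le> enat n"
  shows "graph_dist G u w \<le> enat (m + n)"
proof -
  obtain p where p: "path_between G u v p" "path_length p \<le> m" using assms(1) by (rule graph_dist_leE)
  obtain q where q: "path_between G v w q" "path_length q \<le> n" using assms(2) by (rule graph_dist_leE)
  note wp = path_between_imp_walk[OF p(1)] and wq = path_between_imp_walk[OF q(1)]
  note w = is_walk_append_tl[of G p q]
  have "graph_dist G u w \<le> enat (length (p @ tl q) - 1)"
    using graph_dist_le_walk[of G "p @ tl q"] w wp wq by simp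
  also have "\<dots> \<le> enat (m + n)"
    using p(2) q(2) wp wq by (cases p; cases q) (auto simp: path_length_def is_walk_def)
  finally show ?thesis .
qed

lemma graph_dist_nth_le:
  assumes p: "is_walk G p" and ij: "i \<le> j" "j < length p"
  shows "graph_dist G (p ! i) (p ! j) \<le> enat (j - i)"
proof -
  let ?q = "drop i (take (Suc j) p)"
  have "is_walk G ?q" using p ij by (intro is_walk_drop is_walk_take) auto
  from graph_dist_le_walk[OF this] show ?thesis
    using ij by (simp add: hd_drop_conv_nth last_conv_nth)
qed

lemma graph_dist_sym_le:
  assumes "graph_dist G u v \<le> enat n"
  shows "graph_dist G v u \<le> enat n"
proof -
  obtain p where p: "path_between G u v p" "path_length p \<le> n" using assms by (rule graph_dist_leE)
  have "graph_dist G v u \<le> enat (path_length (rev p))"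
    unfolding graph_dist_def using path_between_rev[OF p(1)] by (intro INF_lower) simp
  also have "\<dots> \<le> enat n" using p(2) by (simp add: path_length_def)
  finally show ?thesis .
qed

text \<open>A shortcut of length \<open>k\<close> between two positions, completed by the initial
  and final segments of the geodesic, cannot beat the geodesic itself.\<close>

lemma shortest_path_nth_dist:
  assumes p: "shortest_path G x y p" and ij: "i \<le> j" "j < length p"
    and le: "graph_dist G (p ! i) (p ! j) \<le> enat k"
  shows "j - i \<le> k"
proof -
  have w: "is_walk G p" "hd p = x" "last p = y" "p \<noteq> []"
    using p path_between_imp_walk[of G x y p] by (auto simp: shortest_path_def is_walk_def)
  have xi: "graph_dist G x (p ! i) \<le> enat i"
    using graph_dist_nth_le[of G p 0 i] w ij by (simp add: hd_conv_nth)
  have jy: "graph_dist G (p ! j) y \<le> enat (length p - 1 - j)"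
    using graph_dist_nth_le[of G p j "length p - 1"] w ij by (auto simp: last_conv_nth)
  have "graph_dist G x y \<le> enat (i + k + (length p - 1 - j))"
    by (intro graph_dist_triangle[OF _ jy] graph_dist_triangle[OF xi le])
  moreover have "graph_dist G x y = enat (length p - 1)"
    using p by (simp add: shortest_path_def path_length_def)
  ultimately show ?thesis using ij by simp
qed

text \<open>Telescoping along a path. With \<open>f\<close> a coordinate, this supplies the lower
  bounds for distances in the grid.\<close>

lemma lipschitz_le_graph_dist:
  fixes f :: "'a \<Rightarrow> int"
  assumes lip: "\<And>u v. {u, v} \<in> edges G \<Longrightarrow> \<bar>f u - f v\<bar> \<le> 1"
  shows "enat (nat \<bar>f x - f y\<bar>) \<le> graph_dist G x y"
  unfolding graph_dist_def
proof (rule INF_greatest, clarify)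
  fix p assume p: "path_between G x y p"
  have "\<bar>f (hd q) - f (last q)\<bar> \<le> int (length q - 1)"
    if "q \<noteq> []" "successively (\<lambda>u v. {u, v} \<in> edges G) q" for q
    using that
  proof (induction q)
    case (Cons a q)
    show ?case
    proof (cases "q = []")
      case False
      with Cons.prems have "\<bar>f a - f (hd q)\<bar> \<le> 1"
        by (auto simp: successively_Cons intro: lip)
      moreover have "\<bar>f (hd q) - f (last q)\<bar> \<le> int (length q - 1)"
        using False Cons.prems by (intro Cons.IH) (auto simp: successively_Cons)
      moreover have "int (length q - 1) = int (length q) - 1" using False by (cases q) auto
      ultimately show ?thesis using False by simp
    qed simp
  qed simp
  from this[of p] p show "enat (nat \<bar>f x - f y\<bar>) \<le> enat (path_length p)"
    by (simp add: path_between_def is_path_def path_length_def)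
qed

section \<open>The upper bound\<close>

text \<open>Either \<open>p\<close> and \<open>q\<close> are disjoint and the edge between
  \<open>r\<close> and \<open>s\<close> joins them to a path, or they meet and close a cycle through
  this edge.\<close>

lemma tree_edge_separates:
  assumes T: "is_tree T" and e: "{r, s} \<in> edges T"
    and p: "path_between T a r p" "s \<notin> set p"
    and q: "path_between T b s q" "r \<notin> set q"
  shows "\<exists>c. path_between T a b c \<and> r \<in> set c \<and> s \<in> set c"
proof (cases "set p \<inter> set q = {}")
  case True
  have "p \<noteq> []" "q \<noteq> []" using p q by (auto simp: path_between_def is_path_def)
  moreover have "r \<in> set p" "s \<in> set q"
    using p q last_in_set by (fastforce simp: path_between_def is_path_def)+
  ultimately show ?thesis
    using p path_between_rev[OF q(1)] True e
    by (intro exI[of _ "p @ rev q"])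
      (auto simp: path_between_def is_path_def successively_append_iff last_rev hd_rev)
next
  case False
  then have "\<exists>c\<in>set p. c \<in> set q" by blast
  \<comment> \<open>Since \<open>c\<close> is the last vertex of \<open>p\<close> on
    \<open>q\<close>, going from \<open>s\<close> back along \<open>q\<close> to \<open>c\<close>
    and then along \<open>p2\<close> to \<open>r\<close> repeats no vertex.\<close>
  then obtain p1 c p2 where p': "p = p1 @ c # p2" "c \<in> set q" "\<forall>u\<in>set p2. u \<notin> set q"
    by (auto simp: split_list_last_prop_iff)
  obtain q1 q2 where q': "q = q1 @ c # q2" using p'(2) by (meson split_list)
  have cr: "c \<noteq> r" "c \<noteq> s" using p q p' by auto
  have ne: "p2 \<noteq> []" "q2 \<noteq> []" using p q p' q' cr by (auto simp: path_between_def)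
  have walk_q: "path_between T s c (rev (c # q2))"
    using q unfolding q' by (intro path_between_rev)
      (auto simp: path_between_def is_path_def successively_append_iff)
  have "is_path T (rev (c # q2) @ p2)"
    using walk_q p ne p' q' unfolding path_between_def is_path_def
    by (fastforce simp: successively_append_iff successively_Cons)
  moreover have "hd (rev (c # q2) @ p2) = s" "last (rev (c # q2) @ p2) = r"
    using walk_q p ne p' by (auto simp: path_between_def hd_append)
  moreover have "length (rev (c # q2) @ p2) \<ge> 3" using ne by (cases p2; cases q2) auto
  ultimately have "is_cycle T (rev (c # q2) @ p2)" using e by (simp add: is_cycle_def)
  with T show ?thesis unfolding is_tree_def by blast
qed

text \<open>\<open>U\<close> is the union of the parts on the side of \<open>r\<close>. By (T3) a
  vertex occurring on both sides of the edge lies in the adhesion set, so edges of \<open>G\<close>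
  leave \<open>U\<close> only from there. A single \<open>U\<close> serves all walks, because
  several of them are compared later.\<close>

lemma adhesion_set_separates:
  assumes td: "tree_decomposition G T part" and e: "{r, s} \<in> edges T"
    and p: "path_between T a r p" "s \<notin> set p"
    and u: "u \<in> part a" and v: "v \<in> part s" "v \<notin> part r"
  shows "\<exists>U. u \<in> U \<and> v \<notin> U \<and>
    (\<forall>w. is_walk G w \<longrightarrow> set w \<inter> (part r \<inter> part s) = {} \<longrightarrow> set w \<inter> U = {} \<or> set w \<subseteq> U)"
proof -
  have T: "is_tree T" and conn: "connected_graph T" and simple: "simple_graph T"
    and T2: "\<And>e. e \<in> edges G \<Longrightarrow> \<exists>t\<in>verts T. e \<subseteq> part t"
    and T3: "\<And>t1 t2 t3 p. path_between T t1 t3 p \<Longrightarrow> t2 \<in> set p \<Longrightarrow> part t1 \<inter> part t3 \<subseteq> part t2"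
    using td unfolding tree_decomposition_def is_tree_def by (simp_all, blast+)
  have "card {r, s} = 2" "s \<in> verts T" using simple e by (auto simp: simple_graph_def)
  then have rs: "r \<noteq> s" "s \<in> verts T" by auto
  define A where "A = {t. \<exists>p. path_between T t r p \<and> s \<notin> set p}"
  define B where "B = {t. \<exists>p. path_between T t s p \<and> r \<notin> set p}"
  define U where "U = (\<Union>t\<in>A. part t)"
  have sep: "w \<in> part r \<inter> part s" if w: "w \<in> U" "w \<in> part t" "t \<in> B" for w t
  proof -
    obtain t' where t': "t' \<in> A" "w \<in> part t'" using w by (auto simp: U_def)
    obtain c where "path_between T t' t c" "r \<in> set c" "s \<in> set c"
      using tree_edge_separates[OF T e] t'(1) w(3) unfolding A_def B_def by blast
    then show ?thesis using T3 t' w by blast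
  qed
  \<comment> \<open>A path from \<open>t\<close> to \<open>s\<close> either avoids \<open>r\<close>,
    or its segment up to \<open>r\<close> stops before the last vertex \<open>s\<close>.\<close>
  have cover: "t \<in> A \<or> t \<in> B" if t: "t \<in> verts T" for t
  proof -
    obtain c where c: "path_between T t s c" using conn t rs(2) unfolding connected_graph_def by blast
    show ?thesis
    proof (cases "r \<in> set c")
      case True
      then obtain c1 c2 where c': "c = c1 @ r # c2" by (meson split_list)
      then have "path_between T t r (c1 @ [r])"
        using c by (auto simp: path_between_def is_path_def successively_append_iff hd_append)
      moreover have "s \<notin> set (c1 @ [r])"
      proof -
        have "distinct c" "last c = s" using c by (simp_all add: path_between_def is_path_def)
        then show ?thesis using rs(1) unfolding c' by (cases c2 rule: rev_cases) auto
      qed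
      ultimately show ?thesis by (auto simp: A_def)
    qed (use c in \<open>auto simp: B_def\<close>)
  qed
  have step: "y \<in> U" if xy: "{x, y} \<in> edges G" "x \<in> U" "x \<notin> part r \<inter> part s" for x y
  proof -
    \<comment> \<open>If \<open>t\<close> is in \<open>A\<close>, then \<open>y\<close> is in
      \<open>U\<close>; if \<open>t\<close> were in \<open>B\<close>, then \<open>sep\<close> would
      put \<open>x\<close> into the adhesion set.\<close>
    obtain t where t: "t \<in> verts T" "{x, y} \<subseteq> part t" using T2 xy by blast
    with cover[OF t(1)] sep[of x t] xy show ?thesis by (auto simp: U_def)
  qed
  have walk: "set w \<inter> U = {} \<or> set w \<subseteq> U"
    if "successively (\<lambda>u v. {u, v} \<in> edges G) w" "set w \<inter> (part r \<inter> part s) = {}" for w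
    using that
  proof (induction w)
    case (Cons a w)
    show ?case
    proof (cases "w = []")
      case False
      with Cons.prems have "{a, hd w} \<in> edges G" "{hd w, a} \<in> edges G"
        by (auto simp: successively_Cons insert_commute)
      moreover have "hd w \<in> set w" using False by simp
      ultimately have "a \<in> U \<longleftrightarrow> hd w \<in> U" using step[of a "hd w"] step[of "hd w" a] Cons.prems by auto
      moreover have "set w \<inter> U = {} \<or> set w \<subseteq> U"
        using Cons by (auto simp: successively_Cons)
      ultimately show ?thesis using \<open>hd w \<in> set w\<close> by auto
    qed auto
  qed auto
  have "path_between T s s [s]" using rs by (simp add: path_between_def is_path_def)
  then have "s \<in> B" using rs by (auto simp: B_def intro!: exI[of _ "[s]"])
  then have "v \<notin> U" using sep v by blast
  moreover have "u \<in> U" using p u by (auto simp: U_def A_def)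
  ultimately show ?thesis using walk unfolding is_walk_def by (intro exI[of _ U]) blast
qed

section \<open>Geodesics stay near walks with the same ends\<close>

text \<open>\<open>Q\<close> is an arbitrary walk, so that two sides of a triangle can be
  concatenated to it whatever vertices they share.\<close>

lemma geodesic_near_walk:
  assumes td: "tree_decomposition G T part"
    and len: "\<And>t u v. t \<in> verts T \<Longrightarrow> u \<in> part t \<Longrightarrow> v \<in> part t \<Longrightarrow> graph_dist G u v \<le> enat d"
    and P: "shortest_path G x y P" and v: "v \<in> set P"
    and Q: "is_walk G Q" "hd Q = x" "last Q = y"
  shows "\<exists>w\<in>set Q. graph_dist G v w \<le> enat (3 * d div 2)"
proof -
  have T: "connected_graph T" and T1: "verts G = (\<Union>t\<in>verts T. part t)"
    using td unfolding tree_decomposition_def is_tree_def by simp_all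
  have wP: "is_walk G P" "hd P = x" "last P = y" "P \<noteq> []"
    using P path_between_imp_walk[of G x y P] by (auto simp: shortest_path_def is_walk_def)
  have xQ: "x \<in> set Q" and yQ: "y \<in> set Q" using Q by (auto simp: is_walk_def)
  obtain t0 where t0: "t0 \<in> verts T" "v \<in> part t0" using v wP T1 by (auto simp: is_walk_def)
  obtain t1 where t1: "t1 \<in> verts T" "x \<in> part t1" using xQ Q T1 by (auto simp: is_walk_def)
  show ?thesis
  proof (cases "part t0 \<inter> set Q = {}")
    case False
    then obtain w where w: "w \<in> part t0" "w \<in> set Q" by blast
    then have "graph_dist G v w \<le> enat d" using len t0 by blast
    also have "\<dots> \<le> enat (3 * d div 2)" by simp
    finally show ?thesis using w by blast
  next
    case True
    obtain c where c: "path_between T t0 t1 c" using T t0 t1 by (auto simp: connected_graph_def)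
    then have "t1 \<in> set c" using last_in_set[of c] by (auto simp: path_between_def is_path_def)
    then have "\<exists>t\<in>set c. part t \<inter> set Q \<noteq> {}" using t1 xQ by blast
    \<comment> \<open>The search stops at \<open>t1\<close> at the latest, whose part contains
      \<open>x\<close>, and not at \<open>t0\<close>, by the case assumption; so \<open>s\<close>
      has a predecessor \<open>r\<close> on \<open>c\<close>.\<close>
    then obtain c1 s c2 where s: "c = c1 @ s # c2" "part s \<inter> set Q \<noteq> {}"
      "\<forall>t\<in>set c1. part t \<inter> set Q = {}"
      by (auto simp: split_list_first_prop_iff)
    define r where "r = last c1"
    have c1: "c1 \<noteq> []" using s c True by (auto simp: path_between_def)
    have e: "{r, s} \<in> edges T" and a: "path_between T t0 r c1" "s \<notin> set c1"
      using c c1 unfolding s(1) r_def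
      by (auto simp: path_between_def is_path_def successively_append_iff)
    have sT: "s \<in> verts T" using c s by (auto simp: path_between_def is_path_def)
    have rQ: "part r \<inter> set Q = {}" using s(3) c1 by (simp add: r_def)
    obtain q where q: "q \<in> part s" "q \<in> set Q" using s(2) by blast
    then have "q \<notin> part r" using rQ by blast
    from adhesion_set_separates[OF td e a t0(2) q(1) this] obtain U
      where U: "v \<in> U" "q \<notin> U"
        "\<And>w. is_walk G w \<Longrightarrow> set w \<inter> (part r \<inter> part s) = {} \<Longrightarrow> set w \<inter> U = {} \<or> set w \<subseteq> U"
      by blast
    \<comment> \<open>\<open>Q\<close> misses the part of \<open>r\<close>, hence the adhesion set,
      and its vertex \<open>q\<close> is outside \<open>U\<close>. So all of \<open>Q\<close> is
      outside \<open>U\<close>, including the ends that it shares with \<open>P\<close>.\<close>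
    have "set Q \<inter> U = {}" using U(3)[OF Q(1)] rQ q U(2) by blast
    then have xyU: "x \<notin> U" "y \<notin> U" using xQ yQ by blast+
    obtain i where i: "i < length P" "v = P ! i" using v by (metis in_set_conv_nth)
    have "v \<in> set (take (Suc i) P)"
      using i by (simp add: take_Suc_conv_app_nth)
    moreover have "x \<in> set (take (Suc i) P)"
      using wP by (cases P) auto
    \<comment> \<open>The segment of \<open>P\<close> from \<open>x\<close> to \<open>v\<close>
      begins outside \<open>U\<close> and ends inside, so it meets the adhesion set. The same
      argument then applies to the segment from \<open>v\<close> to \<open>y\<close>.\<close>
    ultimately have "set (take (Suc i) P) \<inter> (part r \<inter> part s) \<noteq> {}"
      using U(3)[OF is_walk_take[OF wP(1), of "Suc i"]] U(1) xyU by blast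
    then obtain i1 where i1: "i1 \<le> i" "P ! i1 \<in> part r \<inter> part s"
      by (fastforce simp: in_set_conv_nth less_Suc_eq_le)
    have "v \<in> set (drop i P)" "y \<in> set (drop i P)"
      using i wP by (metis Cons_nth_drop_Suc list.set_intros(1), metis drop_eq_Nil last_drop last_in_set not_less)
    then have "set (drop i P) \<inter> (part r \<inter> part s) \<noteq> {}"
      using U(3)[OF is_walk_drop[OF wP(1) i(1)]] U(1) xyU by blast
    then obtain k where "k < length P - i" "P ! (i + k) \<in> part r \<inter> part s"
      by (fastforce simp: in_set_conv_nth)
    then obtain i2 where i2: "i \<le> i2" "i2 < length P" "P ! i2 \<in> part r \<inter> part s"
      by (metis add.commute le_add1 less_diff_conv)
    have "i2 - i1 \<le> d"
      using shortest_path_nth_dist[OF P, of i1 i2 d] len[OF sT] i1 i2 by auto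
    \<comment> \<open>The two gaps add up to at most \<open>d\<close>, so the smaller one is at most
      \<open>d div 2\<close>.\<close>
    then have "i - i1 \<le> d div 2 \<or> i2 - i \<le> d div 2" using i1 i2 by linarith
    then obtain w where w: "w \<in> part s" "graph_dist G v w \<le> enat (d div 2)"
    proof
      assume "i - i1 \<le> d div 2"
      then have "graph_dist G (P ! i1) v \<le> enat (d div 2)"
        using order.trans[OF graph_dist_nth_le[OF wP(1) i1(1) i(1)], of "enat (d div 2)"] i(2) by simp
      from that[OF _ graph_dist_sym_le[OF this]] i1 show ?thesis by simp
    next
      assume "i2 - i \<le> d div 2"
      then have "graph_dist G v (P ! i2) \<le> enat (d div 2)"
        using order.trans[OF graph_dist_nth_le[OF wP(1) i2(1,2)], of "enat (d div 2)"] i(2) by simp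
      from that[OF _ this] i2 show ?thesis by simp
    qed
    have "graph_dist G v q \<le> enat (d div 2 + d)"
      using graph_dist_triangle[OF w(2) len[OF sT w(1) q(1)]] .
    moreover have "d div 2 + d = 3 * d div 2" by presburger
    ultimately show ?thesis using q by auto
  qed
qed

text \<open>A nonempty set of values in \<open>enat\<close> has a minimum, and finiteness of the
  tree-length rules out the empty set, whose infimum is infinite.\<close>

lemma tree_length_attained:
  assumes "tree_length G = enat d"
  obtains T :: "'a list graph" and part :: "'a list \<Rightarrow> 'a set"
  where "tree_decomposition G T part" "decomposition_length G T part = enat d"
proof -
  let ?S = "{decomposition_length G T part | (T :: 'a list graph) part. tree_decomposition G T part}"
  have "?S \<noteq> {}"
  proof
    assume "?S = {}"
    then have "tree_length G = Inf {}" unfolding tree_length_def by (rule arg_cong)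
    with assms show False by (simp add: Inf_enat_def)
  qed
  then obtain k where "k \<in> ?S" by blast
  then have "Inf ?S \<in> ?S" by (rule wellorder_InfI)
  then show ?thesis using that assms unfolding tree_length_def by auto
qed

lemma floor_three_halves: "\<lfloor>3 / 2 * real d\<rfloor> = int (3 * d div 2)"
  using floor_divide_of_nat_eq[of "3 * d" 2, where ?'a = real] by simp

lemma tree_length_imp_hyperbolic:
  fixes G :: "'a graph"
  assumes "tree_length G = enat d"
  shows "hyperbolic (real (3 * d div 2)) G"
proof -
  obtain T :: "'a list graph" and part
    where td: "tree_decomposition G T part" and l: "decomposition_length G T part = enat d"
    using assms by (rule tree_length_attained)
  have len: "graph_dist G u v \<le> enat d" if "t \<in> verts T" "u \<in> part t" "v \<in> part t" for t u v
    unfolding l[symmetric] decomposition_length_def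
    using that by (intro SUP_upper2[of t] SUP_upper2[of u] SUP_upper2[of v] order.refl)
  have near: "within_dist G (real (3 * d div 2)) (set P) (set Q)"
    if "shortest_path G x y P" "is_walk G Q" "hd Q = x" "last Q = y" for x y P Q
    unfolding within_dist_def
  proof
    fix v assume "v \<in> set P"
    then have "\<exists>w\<in>set Q. graph_dist G v w \<le> enat (3 * d div 2)"
      using that by (intro geodesic_near_walk[OF td]) (use len in auto)
    then obtain w where "w \<in> set Q" "graph_dist G v w \<le> enat (3 * d div 2)" by blast
    moreover from this(2) have "ereal_of_enat (graph_dist G v w) \<le> ereal_of_enat (enat (3 * d div 2))"
      by (simp only: ereal_of_enat_le_iff)
    ultimately show "\<exists>w\<in>set Q. ereal_of_enat (graph_dist G v w) \<le> ereal (real (3 * d div 2))"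
      by auto
  qed
  show ?thesis
    unfolding hyperbolic_def
  proof (intro ballI allI impI, elim conjE, intro conjI)
    fix x y z Pxy Pyz Pxz
    assume P: "shortest_path G x y Pxy" "shortest_path G y z Pyz" "shortest_path G x z Pxz"
    have w: "is_walk G Pxy" "hd Pxy = x" "last Pxy = y" "is_walk G Pyz" "hd Pyz = y" "last Pyz = z"
      "is_walk G Pxz" "hd Pxz = x" "last Pxz = z"
      using P by (auto simp: shortest_path_def dest!: path_between_imp_walk)
    \<comment> \<open>For each side, the other two are traversed in the directions that make the
      ends of the joined walk match.\<close>
    note r = is_walk_append_tl
    show "within_dist G (real (3 * d div 2)) (set Pxy) (set Pyz \<union> set Pxz)"
      using near[OF P(1), of "Pxz @ tl (rev Pyz)"] r[of G Pxz "rev Pyz"] w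
      by (simp add: is_walk_rev hd_rev last_rev Un_commute)
    show "within_dist G (real (3 * d div 2)) (set Pyz) (set Pxy \<union> set Pxz)"
      using near[OF P(2), of "rev Pxy @ tl Pxz"] r[of G "rev Pxy" Pxz] w
      by (simp add: is_walk_rev hd_rev last_rev)
    show "within_dist G (real (3 * d div 2)) (set Pxz) (set Pxy \<union> set Pyz)"
      using near[OF P(3), of "Pxy @ tl Pyz"] r[of G Pxy Pyz] w by simp
  qed
qed

section \<open>Sharpness\<close>

text \<open>For \<open>k = 3\<close> this is the tree of the grid decomposition: the centre stands
  for the central rectangle, the leaves for the three rectangles around it.\<close>

definition star :: "nat \<Rightarrow> nat graph" where
  "star k = Graph {..k} {{0, i} | i. 1 \<le> i \<and> i \<le> k}"

lemma star_edge: "{u, v} \<in> edges (star k) \<longleftrightarrow> u \<le> k \<and> v \<le> k \<and> (u = 0 \<and> v \<noteq> 0 \<or> v = 0 \<and> u \<noteq> 0)"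
  by (auto simp: star_def doubleton_eq_iff)

lemma is_tree_star: "is_tree (star k)"
  unfolding is_tree_def
proof (intro conjI)
  show "simple_graph (star k)" by (auto simp: simple_graph_def star_def card_2_iff)
  have 0: "\<exists>p. path_between (star k) 0 x p" if "x \<le> k" for x
    using that by (cases "x = 0")
      (auto simp: path_between_def is_path_def star_edge star_def[THEN arg_cong[of _ _ verts]]
        intro: exI[of _ "[0, x]"] exI[of _ "[0]"])
  show "connected_graph (star k)"
    unfolding connected_graph_def
  proof (intro conjI ballI)
    show "verts (star k) \<noteq> {}" by (simp add: star_def)
    fix x y assume "x \<in> verts (star k)" "y \<in> verts (star k)"
    then have "x \<le> k" "y \<le> k" by (auto simp: star_def)
    then show "\<exists>p. path_between (star k) x y p"
      using 0 path_between_rev path_between_trans by metis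
  qed
  show "\<nexists>c. is_cycle (star k) c"
  proof
    assume "\<exists>c. is_cycle (star k) c"
    then obtain c where c: "is_cycle (star k) c" by blast
    then have "length c \<ge> 3" by (simp add: is_cycle_def)
    \<comment> \<open>The edges \<open>c0 c1\<close>, \<open>c1 c2\<close> and the closing edge have
      no common vertex, whereas every edge of a star contains \<open>0\<close>.\<close>
    then obtain c0 c1 c2 cs where "c = c0 # c1 # c2 # cs"
      by (metis (no_types, opaque_lifting) Suc_le_length_iff numeral_3_eq_3)
    with c last_in_set[of "c2 # cs"] show False
      by (auto simp: is_cycle_def is_path_def star_edge simp del: last_in_set split: if_splits)
  qed
qed

text \<open>An inner vertex of a path has two distinct neighbours, but a leaf has only one.\<close>

lemma path_star:
  assumes p: "path_between (star k) t1 t3 p" and t: "t2 \<in> set p" "t2 \<noteq> t1" "t2 \<noteq> t3"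
  shows "t2 = 0"
proof (rule ccontr)
  assume "t2 \<noteq> 0"
  obtain p1 p2 where p': "p = p1 @ t2 # p2" using t by (meson split_list)
  then have ne: "p1 \<noteq> []" "p2 \<noteq> []" using p t by (auto simp: path_between_def)
  then have "{last p1, t2} \<in> edges (star k)" "{t2, hd p2} \<in> edges (star k)"
    using p p' by (auto simp: path_between_def is_path_def successively_append_iff successively_Cons)
  moreover have "set p1 \<inter> set p2 = {}" using p p' by (auto simp: path_between_def is_path_def)
  then have "last p1 \<noteq> hd p2" using ne by (metis disjoint_iff hd_in_set last_in_set)
  ultimately show False using \<open>t2 \<noteq> 0\<close> by (auto simp: star_edge)
qed

section \<open>The grid and its decomposition into rectangles\<close>

text \<open>Part \<open>0\<close> is the central rectangle; the grid points are coded by \<^const>\<open>prod_encode\<close>.\<close>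

definition bag :: "nat \<Rightarrow> nat \<Rightarrow> nat set" where
  "bag d t = prod_encode `
     (if t = 0 then {d..2 * d} \<times> {d div 2..d div 2 + d}
      else if t = 1 then {0..d} \<times> {d div 2..d div 2 + d}
      else if t = 2 then {2 * d..3 * d} \<times> {d div 2..d div 2 + d}
      else {d..2 * d} \<times> {0..d div 2})"

definition king_adj :: "nat \<Rightarrow> nat \<Rightarrow> bool" where
  "king_adj u v \<longleftrightarrow> (case (prod_decode u, prod_decode v) of ((a, b), (a', b')) \<Rightarrow>
     u \<noteq> v \<and> \<bar>int a - int a'\<bar> \<le> 1 \<and> \<bar>int b - int b'\<bar> \<le> 1)"

text \<open>Requiring a common rectangle gives (T2) at once. For \<open>d \<ge> 2\<close> it
  excludes the diagonal moves around the reentrant corners, such as from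
  \<open>(d - 1, d div 2)\<close> to \<open>(d, d div 2 - 1)\<close>.\<close>

definition king_graph :: "nat \<Rightarrow> nat graph" where
  "king_graph d = Graph (\<Union>t\<le>3. bag d t) {{u, v} | u v. king_adj u v \<and> (\<exists>t\<le>3. u \<in> bag d t \<and> v \<in> bag d t)}"

lemma king_adj_sym: "king_adj u v \<longleftrightarrow> king_adj v u"
  by (auto simp: king_adj_def abs_minus_commute split: prod.splits)

lemma king_adj_encode:
  "king_adj (prod_encode (a, b)) (prod_encode (a', b')) \<longleftrightarrow>
    (a, b) \<noteq> (a', b') \<and> \<bar>int a - int a'\<bar> \<le> 1 \<and> \<bar>int b - int b'\<bar> \<le> 1"
  by (simp add: king_adj_def)

lemma verts_king: "verts (king_graph d) = (\<Union>t\<le>3. bag d t)"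
  by (simp add: king_graph_def)

lemma edges_king:
  "{u, v} \<in> edges (king_graph d) \<longleftrightarrow> king_adj u v \<and> (\<exists>t\<le>3. u \<in> bag d t \<and> v \<in> bag d t)"
  unfolding king_graph_def graph.sel by (auto simp: doubleton_eq_iff king_adj_sym)

lemma simple_king: "simple_graph (king_graph d)"
  by (auto simp: simple_graph_def king_graph_def card_2_iff king_adj_def)

lemma encode_in_bag:
  "prod_encode (a, b) \<in> bag d t \<longleftrightarrow>
    (if t = 0 then d \<le> a \<and> a \<le> 2 * d \<and> d div 2 \<le> b \<and> b \<le> d div 2 + d
     else if t = 1 then a \<le> d \<and> d div 2 \<le> b \<and> b \<le> d div 2 + d
     else if t = 2 then 2 * d \<le> a \<and> a \<le> 3 * d \<and> d div 2 \<le> b \<and> b \<le> d div 2 + d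
     else d \<le> a \<and> a \<le> 2 * d \<and> b \<le> d div 2)"
  by (auto simp: bag_def)

text \<open>This gives (T3), because the only possible inner node of a path in the star is
  \<open>0\<close>.\<close>

lemma bag_inter: "t \<noteq> t' \<Longrightarrow> t \<le> 3 \<Longrightarrow> t' \<le> 3 \<Longrightarrow> bag d t \<inter> bag d t' \<subseteq> bag d 0"
proof (rule subsetI)
  fix u assume u: "t \<noteq> t'" "t \<le> 3" "t' \<le> 3" "u \<in> bag d t \<inter> bag d t'"
  obtain a b where ab: "u = prod_encode (a, b)" by (metis prod_decode_inverse surj_pair)
  have "t \<in> {0, 1, 2, 3}" "t' \<in> {0, 1, 2, 3}" using u by auto
  with u show "u \<in> bag d 0" unfolding ab by (auto simp: encode_in_bag)
qed

text \<open>Diagonal moves let both coordinates approach their targets simultaneously, and a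
  rectangle contains all intermediate points.\<close>

lemma king_dist_le:
  assumes "t \<le> 3" "prod_encode (a, b) \<in> bag d t" "prod_encode (a', b') \<in> bag d t"
    "\<bar>int a - int a'\<bar> \<le> int n" "\<bar>int b - int b'\<bar> \<le> int n"
  shows "graph_dist (king_graph d) (prod_encode (a, b)) (prod_encode (a', b')) \<le> enat n"
  using assms(2,4,5)
proof (induction n arbitrary: a b)
  case 0
  then have "a = a'" "b = b'" by auto
  then show ?case using assms graph_dist_self[of _ "king_graph d"] by (fastforce simp: verts_king zero_enat_def)
next
  case (Suc n)
  \<comment> \<open>A coordinate moves one unit towards its target and rests once it is there. Hence
    \<open>?v\<close> may equal \<open>?u\<close>, and then no edge is used.\<close>
  define step where "step = (\<lambda>a a' :: nat. if a < a' then a + 1 else if a' < a then a - 1 else a)"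
  let ?u = "prod_encode (a, b)" and ?v = "prod_encode (step a a', step b b')"
  have v: "?v \<in> bag d t"
    using Suc.prems(1) assms(3) by (auto simp: encode_in_bag step_def split: if_splits)
  have "graph_dist (king_graph d) ?v (prod_encode (a', b')) \<le> enat n"
    using v Suc.prems by (intro Suc.IH) (auto simp: step_def)
  moreover have "graph_dist (king_graph d) ?u ?v \<le> enat 1"
  proof (cases "?u = ?v")
    case True
    have "?u \<in> verts (king_graph d)" using Suc.prems assms(1) by (auto simp: verts_king)
    then have "graph_dist (king_graph d) ?u ?u \<le> enat 1" by (simp add: graph_dist_self)
    then show ?thesis using True by simp
  next
    case False
    then have "king_adj ?u ?v" by (auto simp: king_adj_encode step_def)
    then have "is_walk (king_graph d) [?u, ?v]"
      using v Suc.prems assms(1) by (auto simp: is_walk_def verts_king edges_king)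
    from graph_dist_le_walk[OF this] show ?thesis by simp
  qed
  ultimately show ?case using graph_dist_triangle[of "king_graph d" ?u ?v 1] by fastforce
qed

lemma bag_dist_le:
  assumes "t \<le> 3" "u \<in> bag d t" "v \<in> bag d t"
  shows "graph_dist (king_graph d) u v \<le> enat d"
proof -
  obtain a b where u: "u = prod_encode (a, b)" by (metis prod_decode_inverse surj_pair)
  obtain a' b' where v: "v = prod_encode (a', b')" by (metis prod_decode_inverse surj_pair)
  show ?thesis
    using assms unfolding u v
    by (intro king_dist_le[of t]) (auto simp: encode_in_bag abs_le_iff split: if_splits)
qed

lemma king_tree_length_le: "tree_length (king_graph d) \<le> enat d"
proof -
  have vs: "verts (star 3) = {..3}" by (simp add: star_def)
  have "tree_decomposition (king_graph d) (star 3) (bag d)"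
    unfolding tree_decomposition_def
  proof (intro conjI ballI allI impI)
    show "is_tree (star 3)" by (rule is_tree_star)
    show "verts (king_graph d) = (\<Union>t\<in>verts (star 3). bag d t)" by (simp add: vs verts_king)
    show "\<exists>t\<in>verts (star 3). e \<subseteq> bag d t" if "e \<in> edges (king_graph d)" for e
      using that by (auto simp: vs king_graph_def)
    show "bag d t1 \<inter> bag d t3 \<subseteq> bag d t2" if "path_between (star 3) t1 t3 p \<and> t2 \<in> set p" for t1 t2 t3 p
    proof (cases "t2 = t1 \<or> t2 = t3")
      case False
      with that have "t2 = 0" using path_star by blast
      have p: "p \<noteq> []" "set p \<subseteq> {..3}" "hd p = t1" "last p = t3" "distinct p"
        using that by (auto simp: path_between_def is_path_def vs)
      then have "t1 \<le> 3" "t3 \<le> 3" using hd_in_set[of p] last_in_set[of p] by auto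
      moreover have "t1 \<noteq> t3" using p that False by (cases p) (auto split: if_splits)
      ultimately show ?thesis using bag_inter \<open>t2 = 0\<close> by blast
    qed auto
  qed
  \<comment> \<open>The nodes of the star are numbers, while \<open>tree_length\<close> ranges over
    trees on lists; the transfer between node types bridges this.\<close>
  then have "tree_length (king_graph d) \<le> decomposition_length (king_graph d) (star 3) (bag d)"
    by (intro tree_length_le_decomposition_length simple_king)
  also have "\<dots> \<le> enat d"
    unfolding decomposition_length_def using bag_dist_le by (intro SUP_least) (auto simp: vs)
  finally show ?thesis .
qed

section \<open>Two geodesics that are far apart\<close>

text \<open>Each step raises the first coordinate by one, and no edge can raise it faster. Both the
  upper side and the V-shaped path have this form.\<close>

lemma king_geodesic:
  assumes step: "\<And>i. i < 3 * d \<Longrightarrow> {prod_encode (i, h i), prod_encode (Suc i, h (Suc i))} \<in> edges (king_graph d)"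
    and d: "d > 0"
  shows "shortest_path (king_graph d) (prod_encode (0, h 0)) (prod_encode (3 * d, h (3 * d)))
    (map (\<lambda>i. prod_encode (i, h i)) [0..<Suc (3 * d)])"
proof -
  let ?G = "king_graph d"
  let ?p = "map (\<lambda>i. prod_encode (i, h i)) [0..<Suc (3 * d)]"
  have "prod_encode (i, h i) \<in> verts ?G" if "i \<le> 3 * d" for i
  proof (cases "i < 3 * d")
    case True
    then show ?thesis using step[of i] by (auto simp: edges_king verts_king)
  next
    case False
    \<comment> \<open>No step starts at the last vertex, so its membership is read off from the step
      that ends there.\<close>
    then show ?thesis using that d step[of "3 * d - 1"] by (auto simp: edges_king verts_king)
  qed
  moreover have "successively (\<lambda>u v. {u, v} \<in> edges ?G) ?p"
    unfolding successively_conv_nth using step by (auto simp del: upt_Suc)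
  ultimately have p: "path_between ?G (prod_encode (0, h 0)) (prod_encode (3 * d, h (3 * d))) ?p"
    by (auto simp: path_between_def is_path_def distinct_map inj_on_def hd_map last_map simp del: upt_Suc)
  have "enat (nat \<bar>int (fst (prod_decode (prod_encode (0, h 0)))) -
      int (fst (prod_decode (prod_encode (3 * d, h (3 * d)))))\<bar>)
    \<le> graph_dist ?G (prod_encode (0, h 0)) (prod_encode (3 * d, h (3 * d)))"
    by (rule lipschitz_le_graph_dist) (auto simp: edges_king king_adj_def split: prod.splits)
  moreover have "graph_dist ?G (prod_encode (0, h 0)) (prod_encode (3 * d, h (3 * d))) \<le> enat (path_length ?p)"
    unfolding graph_dist_def using p by (intro INF_lower) simp
  ultimately show ?thesis using p by (simp add: shortest_path_def path_length_def nat_mult_distrib)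
qed

lemma king_not_hyperbolic:
  assumes c: "0 \<le> c" "c < real (3 * d div 2)"
  shows "\<not> hyperbolic c (king_graph d)"
proof
  assume hyp: "hyperbolic c (king_graph d)"
  let ?G = "king_graph d"
  define m where "m = d div 2"
  \<comment> \<open>Height of the V with tip over \<open>d + m\<close>. The left arm has height
    \<open>m + d\<close> at \<open>0\<close>; the right arm reaches this height at
    \<open>2 * d + 2 * m\<close>, which is \<open>3 * d\<close> for even \<open>d\<close> and
    \<open>3 * d - 1\<close> for odd \<open>d\<close>. In the odd case \<open>min\<close> makes the
    last step horizontal.\<close>
  define h where "h = (\<lambda>i. min (m + d) (nat \<bar>int i - int (d + m)\<bar>))"
  define P where "P = map (\<lambda>i. prod_encode (i, h i)) [0..<Suc (3 * d)]"
  define Q where "Q = map (\<lambda>i. prod_encode (i, m + d)) [0..<Suc (3 * d)]"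
  let ?x = "prod_encode (0, m + d)" and ?y = "prod_encode (3 * d, m + d)"
  have m: "2 * m = d \<or> 2 * m + 1 = d" "3 * d div 2 = m + d" by (auto simp: m_def)
  have d: "d > 0" using c by (cases d) auto
  have ends: "h 0 = m + d" "h (3 * d) = m + d" using m by (auto simp: h_def)
  have stepP: "{prod_encode (i, h i), prod_encode (Suc i, h (Suc i))} \<in> edges ?G" if "i < 3 * d" for i
  proof -
    have "\<exists>t\<le>3. prod_encode (i, h i) \<in> bag d t \<and> prod_encode (Suc i, h (Suc i)) \<in> bag d t"
    proof -
      consider "i < d" | "d \<le> i" "i < 2 * d" "h i \<le> m" "h (Suc i) \<le> m"
        | "d \<le> i" "i < 2 * d" "m < h i \<or> m < h (Suc i)" | "2 * d \<le> i"
        by linarith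
      then show ?thesis
      proof cases
        case 1
        then show ?thesis
          by (intro exI[of _ 1]) (auto simp: encode_in_bag h_def m_def[symmetric])
      next
        case 2
        then show ?thesis
          by (intro exI[of _ 3]) (auto simp: encode_in_bag m_def[symmetric])
      next
        case 3
        \<comment> \<open>Over \<open>2 * d\<close> the right arm has height \<open>d - m\<close>,
          which exceeds \<open>m\<close> only for odd \<open>d\<close>, and then by one. The step
          ending there goes from height \<open>m\<close> to \<open>m + 1\<close> inside the central
          rectangle.\<close>
        then have "Suc i = 2 * d \<and> 2 * m + 1 = d" using m by (auto simp: h_def split: if_splits)
        then show ?thesis
          by (intro exI[of _ 0]) (auto simp: encode_in_bag h_def m_def[symmetric])
      next
        case 4
        then show ?thesis using that m
          by (intro exI[of _ 2]) (auto simp: encode_in_bag h_def m_def[symmetric])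
      qed
    qed
    moreover have "\<bar>int (h i) - int (h (Suc i))\<bar> \<le> 1" by (simp add: h_def of_nat_min)
    ultimately show ?thesis by (auto simp: edges_king king_adj_encode)
  qed
  have stepQ: "{prod_encode (i, m + d), prod_encode (Suc i, m + d)} \<in> edges ?G" if "i < 3 * d" for i
  proof -
    have "\<exists>t\<le>3. prod_encode (i, m + d) \<in> bag d t \<and> prod_encode (Suc i, m + d) \<in> bag d t"
      using that
      by (intro exI[of _ "if i < d then 1 else if i < 2 * d then 0 else 2"])
        (auto simp: encode_in_bag m_def)
    then show ?thesis by (auto simp: edges_king king_adj_encode)
  qed
  have P: "shortest_path ?G ?x ?y P"
    using king_geodesic[OF stepP d] by (simp only: ends P_def)
  have Q: "shortest_path ?G ?x ?y Q"
    using king_geodesic[OF stepQ d] by (simp only: Q_def)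
  have xy: "?x \<in> verts ?G" "?y \<in> verts ?G"
    using stepQ[of 0] stepQ[of "3 * d - 1"] d by (auto simp: edges_king verts_king)
  \<comment> \<open>The triangle is degenerate: its third vertex is \<open>?y\<close> again, and the
    side between the two copies is a single vertex.\<close>
  then have "shortest_path ?G ?y ?y [?y]"
    by (auto simp: shortest_path_def path_between_def is_path_def path_length_def graph_dist_self
        zero_enat_def)
  then have "within_dist ?G c (set P) (set [?y] \<union> set Q)"
    using hyp P Q xy unfolding hyperbolic_def by blast
  moreover have "prod_encode (d + m, 0) \<in> set P"
    using m by (auto simp: P_def h_def image_iff simp del: upt_Suc intro!: bexI[of _ "d + m"])
  ultimately obtain w where w: "w \<in> set [?y] \<union> set Q"
    "ereal_of_enat (graph_dist ?G (prod_encode (d + m, 0)) w) \<le> ereal c"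
    unfolding within_dist_def by blast
  have wm: "snd (prod_decode w) = m + d" using w(1) by (auto simp: Q_def simp del: upt_Suc)
  have "enat (nat \<bar>int (snd (prod_decode (prod_encode (d + m, 0)))) - int (snd (prod_decode w))\<bar>)
      \<le> graph_dist ?G (prod_encode (d + m, 0)) w"
    by (rule lipschitz_le_graph_dist) (auto simp: edges_king king_adj_def split: prod.splits)
  then have "enat (m + d) \<le> graph_dist ?G (prod_encode (d + m, 0)) w"
    using wm by (simp add: nat_add_distrib add.commute)
  then have "ereal_of_enat (enat (m + d)) \<le> ereal_of_enat (graph_dist ?G (prod_encode (d + m, 0)) w)"
    by (simp only: ereal_of_enat_le_iff)
  also have "\<dots> \<le> ereal c" by (rule w(2))
  finally show False using c(2) m(2) by simp
qed

lemma tree_length_king: "tree_length (king_graph d) = enat d"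
proof (rule ccontr)
  assume "tree_length (king_graph d) \<noteq> enat d"
  with king_tree_length_le obtain k where k: "tree_length (king_graph d) = enat k" "k < d"
    by (metis enat_ile enat_ord_simps(1) order_le_imp_less_or_eq)
  \<comment> \<open>Raising \<open>k\<close> by one raises \<open>3 * k div 2\<close> by at least
    one, so a smaller tree-length would give a hyperbolicity constant that has just been
    excluded.\<close>
  then have "3 * k div 2 < 3 * d div 2" by presburger
  then show False
    using tree_length_imp_hyperbolic[OF k(1)] king_not_hyperbolic[of "real (3 * k div 2)" d] by simp
qed

theorem lemma6p1:
  fixes d :: nat
  shows "(\<forall>G :: 'a graph. simple_graph G \<and> tree_length G = enat d \<longrightarrow>
            hyperbolic (real_of_int \<lfloor>3 / 2 * real d\<rfloor>) G) \<and>
         (\<exists>H :: nat graph. simple_graph H \<and> tree_length H = enat d \<and>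
            (\<forall>c :: real. 0 \<le> c \<and> c < real_of_int \<lfloor>3 / 2 * real d\<rfloor> \<longrightarrow> \<not> hyperbolic c H))"
proof -
  have "real_of_int \<lfloor>3 / 2 * real d\<rfloor> = real (3 * d div 2)"
    by (simp only: floor_three_halves of_int_of_nat_eq)
  then show ?thesis
    using tree_length_imp_hyperbolic simple_king tree_length_king king_not_hyperbolic by metis
qed

end
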